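(* Let $M$ be an $n\times n$ complex matrix with spectral radius $\rho(M)<1$, let $\mathbf{g}\in\mathbb{C}^n$, and let $k$ be a positive integer. Then the iterative processes $$\mathbf{x}^{(m)}=M\mathbf{x}^{(m-1)}+\mathbf{g}$$ and $$\mathbf{x}^{(m)}=M^k\mathbf{x}^{(m-1)}+\mathbf{h},\qquad \mathbf{h}=(I+M+\cdots+M^{k-1})\mathbf{g},$$ converge to the same vector.
   Context: Each process is indexed by $m\geq 1$ and started from an arbitrary initial vector $\mathbf{x}^{(0)}\in\mathbb{C}^n$ (the two initial vectors need not be related). $I$ denotes the $n\times n$ identity matrix. *)

theory Defs
  imports "Jordan_Normal_Form.Spectral_Radius"
begin

text \<open>Type \<open>vec\<close> carries no topology. Convergence in the \<open>n\<close>-dimensional space is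
  convergence in the product topology; for complex entries this is convergence in any norm.\<close>

definition vec_LIMSEQ ::
    "nat \<Rightarrow> (nat \<Rightarrow> 'a :: topological_space vec) \<Rightarrow> 'a vec \<Rightarrow> bool" where
  "vec_LIMSEQ n x v \<longleftrightarrow>
     (\<forall>m. x m \<in> carrier_vec n) \<and> v \<in> carrier_vec n \<and>
     (\<forall>i<n. (\<lambda>m. x m $ i) \<longlonglongrightarrow> v $ i)"

definition affine_iteration ::
    "nat \<Rightarrow> 'a :: semiring_0 mat \<Rightarrow> 'a vec \<Rightarrow> (nat \<Rightarrow> 'a vec) \<Rightarrow> bool" where
  "affine_iteration n A b x \<longleftrightarrow>
     x 0 \<in> carrier_vec n \<and> (\<forall>m\<ge>1. x m = A *\<^sub>v x (m - 1) + b)"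

text \<open>\<open>I + A + \<dots> + A^(k-1)\<close>. Type \<open>mat\<close> is not an additive monoid (the
  zero matrix depends on the dimension), so the sum is taken in the ring of \<open>n \<times> n\<close> matrices.\<close>

definition mat_geometric_sum :: "nat \<Rightarrow> 'a :: comm_ring_1 mat \<Rightarrow> nat \<Rightarrow> 'a mat" where
  "mat_geometric_sum n A k =
     (\<Oplus>\<^bsub>ring_mat TYPE('a) n ()\<^esub> i \<in> {..<k}. A ^\<^sub>m i)"

end

theory Submission
  imports Defs
begin

text \<open>
  Two things make both processes converge, whatever their initial vectors. First, \<open>\<rho>(M) < 1\<close>
  excludes \<open>1\<close> from the spectrum, so \<open>I - M\<close> is invertible and \<open>M v + g = v\<close> has a solution \<open>v\<close>
  (\<open>fixed_point_exists\<close>). Second, \<open>\<rho>(M) < 1\<close> forces \<open>M\<^sup>m\<close> to tend to zero entrywise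
  (\<open>pow_mat_tendsto_zero\<close>). The error of an affine iteration with respect to a fixed point is
  multiplied by the matrix at each step (\<open>affine_iteration_error\<close>); hence it tends to zero.

  The limits agree because \<open>k\<close> steps \<open>x \<mapsto> M x + g\<close> compose to the single step
  \<open>x \<mapsto> M\<^sup>k x + h\<close>: the same \<open>v\<close> is a fixed point of the second process
  (\<open>fixed_point_of_pow\<close>), and the powers of \<open>M\<^sup>k\<close> are a subsequence of the powers of \<open>M\<close>.
\<close>

section \<open>Powers of a matrix of spectral radius below one\<close>

lemma norm_eigenvalue_le_spectral_radius:
  assumes "A \<in> carrier_mat n n" and "eigenvalue A e"
  shows "norm e \<le> spectral_radius A"
  using spectral_radius_mem_max(2)[OF assms(1) eigenvalue_imp_nonzero_dim[OF assms]] assms(2)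
  by (auto simp: spectrum_def)

lemma pow_mat_smult:
  fixes A :: "'a :: comm_semiring_1 mat"
  assumes A: "A \<in> carrier_mat n n"
  shows "(c \<cdot>\<^sub>m A) ^\<^sub>m m = c ^ m \<cdot>\<^sub>m (A ^\<^sub>m m)"
proof (induction m)
  case 0
  show ?case by auto
next
  case (Suc m)
  note Am = pow_carrier_mat[OF A, of m]
  have "(c \<cdot>\<^sub>m A) ^\<^sub>m Suc m = (c ^ m \<cdot>\<^sub>m (A ^\<^sub>m m)) * (c \<cdot>\<^sub>m A)"
    by (simp add: Suc)
  also have "\<dots> = c ^ m \<cdot>\<^sub>m (c \<cdot>\<^sub>m (A ^\<^sub>m m * A))"
    using mult_smult_assoc_mat[OF Am, of "c \<cdot>\<^sub>m A" n] mult_smult_distrib[OF Am A] A by simp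
  also have "\<dots> = c ^ Suc m \<cdot>\<^sub>m (A ^\<^sub>m Suc m)"
    by (intro eq_matI) (auto simp: mult_ac)
  finally show ?case .
qed

lemma pow_mat_pow_mat:
  fixes A :: "'a :: semiring_1 mat"
  assumes A: "A \<in> carrier_mat n n"
  shows "(A ^\<^sub>m k) ^\<^sub>m m = A ^\<^sub>m (k * m)"
proof -
  interpret semiring "ring_mat TYPE('a) n ()" by (rule semiring_mat)
  show ?thesis
    using nat_pow_pow[of A k m] A pow_mat_ring_pow[OF pow_carrier_mat[OF A], of k m "()"]
    by (simp add: pow_mat_ring_pow[OF A, where b = "()"] ring_mat_simps)
qed

lemma eigenvalue_smult:
  fixes A :: "'a :: field mat"
  assumes A: "A \<in> carrier_mat n n" and c: "c \<noteq> 0" and e: "eigenvalue (c \<cdot>\<^sub>m A) e"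
  shows "eigenvalue A (e / c)"
proof -
  from e A obtain v where v: "v \<in> carrier_vec n" "v \<noteq> 0\<^sub>v n"
    and eq: "(c \<cdot>\<^sub>m A) *\<^sub>v v = e \<cdot>\<^sub>v v"
    by (auto simp: eigenvalue_def eigenvector_def)
  have "A *\<^sub>v v = (e / c) \<cdot>\<^sub>v v"
  proof (rule eq_vecI)
    fix i assume "i < dim_vec ((e / c) \<cdot>\<^sub>v v)"
    with v have i: "i < n" by auto
    have "((c \<cdot>\<^sub>m A) *\<^sub>v v) $ i = (e \<cdot>\<^sub>v v) $ i" by (simp add: eq)
    hence "c * (A *\<^sub>v v) $ i = e * v $ i" using i A v by simp
    thus "(A *\<^sub>v v) $ i = ((e / c) \<cdot>\<^sub>v v) $ i"
      using i v c by (simp add: field_simps)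
  qed (use A v in auto)
  thus ?thesis using A v by (auto simp: eigenvalue_def eigenvector_def)
qed

text \<open>
  Spectral radius below \<open>1\<close> gives bounded powers. There is room to spare: for
  \<open>\<rho>(A) < r < 1\<close> the matrix \<open>A / r\<close> still has spectral radius below \<open>1\<close>, so its powers
  are bounded too, and the entries of \<open>A\<^sup>m\<close> are at most a constant times \<open>r\<^sup>m\<close>.
\<close>

lemma pow_mat_tendsto_zero:
  assumes A: "A \<in> carrier_mat n n" and sr: "spectral_radius A < 1"
    and i: "i < n" and j: "j < n"
  shows "(\<lambda>m. (A ^\<^sub>m m) $$ (i, j)) \<longlonglongrightarrow> 0"
proof -
  have n: "n > 0" using i by simp
  have sr0: "spectral_radius A \<ge> 0"
    using spectral_radius_mem_max(1)[OF A n] by auto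
  obtain r where r: "spectral_radius A < r" "r < 1" using sr dense by blast
  with sr0 have r0: "r > 0" by simp
  let ?c = "complex_of_real (1 / r)"
  let ?B = "?c \<cdot>\<^sub>m A"
  have B: "?B \<in> carrier_mat n n" using A by simp
  have "spectral_radius ?B < 1"
  proof -
    obtain e where e: "eigenvalue ?B e" and eq: "spectral_radius ?B = norm e"
      using spectral_radius_mem_max(1)[OF B n] by (auto simp: spectrum_def)
    have "eigenvalue A (e / ?c)" using eigenvalue_smult[OF A _ e] r0 by simp
    from norm_eigenvalue_le_spectral_radius[OF A this] have "norm e * r \<le> spectral_radius A"
      using r0 by (simp add: norm_mult)
    with r(1) have "norm e * r < 1 * r" by simp
    thus ?thesis using r0 eq by simp
  qed
  from spectral_radius_jnf_norm_bound_less_1_upper_triangular[OF B this]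
  obtain c where c: "\<And>m. norm_bound (?B ^\<^sub>m m) c" by blast
  have bound: "norm ((A ^\<^sub>m m) $$ (i, j)) \<le> c * r ^ m" for m
  proof -
    have "norm ((?B ^\<^sub>m m) $$ (i, j)) \<le> c"
      using c[of m] i j unfolding norm_bound_def pow_mat_dim_square[OF B] by blast
    hence "norm ((?B ^\<^sub>m m) $$ (i, j)) * r ^ m \<le> c * r ^ m"
      using r0 by (intro mult_right_mono) auto
    moreover have "(?B ^\<^sub>m m) $$ (i, j) = ?c ^ m * (A ^\<^sub>m m) $$ (i, j)"
      using i j by (simp add: pow_mat_smult[OF A] carrier_matD[OF A])
    hence "(A ^\<^sub>m m) $$ (i, j) = (?B ^\<^sub>m m) $$ (i, j) * complex_of_real r ^ m"
      using r0 by (simp add: power_one_over)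
    hence "norm ((A ^\<^sub>m m) $$ (i, j)) = norm ((?B ^\<^sub>m m) $$ (i, j)) * r ^ m"
      using r0 by (simp add: norm_mult norm_power)
    ultimately show ?thesis by simp
  qed
  have "(\<lambda>m. c * r ^ m) \<longlonglongrightarrow> 0"
    using r0 r(2) by (auto intro!: tendsto_mult_right_zero LIMSEQ_realpow_zero)
  hence "(\<lambda>m. norm ((A ^\<^sub>m m) $$ (i, j))) \<longlonglongrightarrow> 0"
    by (rule tendsto_sandwich[OF _ _ tendsto_const, rotated 2]) (simp_all add: bound)
  thus ?thesis by (simp only: tendsto_norm_zero_iff)
qed

section \<open>Affine iterations around a fixed point\<close>

text \<open>
  A nonzero vector killed by \<open>I - A\<close> would be an eigenvector of \<open>A\<close> for \<open>1\<close>. Hence \<open>I - A\<close> has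
  an inverse \<open>C\<close>, and the fixed point is \<open>C g\<close>.
\<close>

lemma fixed_point_exists:
  fixes A :: "'a :: field mat"
  assumes A: "A \<in> carrier_mat n n" and g: "g \<in> carrier_vec n" and "\<not> eigenvalue A 1"
  shows "\<exists>v \<in> carrier_vec n. A *\<^sub>v v + g = v"
proof -
  let ?D = "1\<^sub>m n - A"
  have D: "?D \<in> carrier_mat n n" by (rule minus_carrier_mat[OF A])
  have D_mult: "?D *\<^sub>v v = v - A *\<^sub>v v" if "v \<in> carrier_vec n" for v
    using that A by (simp add: minus_mult_distrib_mat_vec[of _ n n])
  have "det ?D \<noteq> 0"
  proof
    assume "det ?D = 0"
    then obtain v where v: "v \<in> carrier_vec n" "v \<noteq> 0\<^sub>v n" and 0: "?D *\<^sub>v v = 0\<^sub>v n"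
      unfolding det_0_iff_vec_prod_zero_field[OF D] by blast
    have "A *\<^sub>v v = v"
    proof (rule eq_vecI)
      fix i assume "i < dim_vec v"
      with v have i: "i < n" by auto
      have "(v - A *\<^sub>v v) $ i = 0" using 0 D_mult[OF v(1)] i by simp
      thus "(A *\<^sub>v v) $ i = v $ i" using i A v by simp
    qed (use A v in auto)
    with v A have "eigenvalue A 1" by (auto simp: eigenvalue_def eigenvector_def)
    with assms(3) show False by simp
  qed
  from det_non_zero_imp_unit[OF D this, of "()"]
  obtain C where C: "C \<in> carrier_mat n n" and DC: "?D * C = 1\<^sub>m n"
    unfolding Units_def ring_mat_def by auto
  have v: "C *\<^sub>v g \<in> carrier_vec n" using C g by simp
  have "?D *\<^sub>v (C *\<^sub>v g) = g"
    using assoc_mult_mat_vec[OF D C g] DC g by simp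
  hence g_eq: "g = C *\<^sub>v g - A *\<^sub>v (C *\<^sub>v g)" using D_mult[OF v] by simp
  have "A *\<^sub>v (C *\<^sub>v g) + g = C *\<^sub>v g"
  proof (rule eq_vecI)
    fix i assume "i < dim_vec (C *\<^sub>v g)"
    hence i: "i < n" using C by simp
    have "g $ i = (C *\<^sub>v g - A *\<^sub>v (C *\<^sub>v g)) $ i" using g_eq by metis
    thus "(A *\<^sub>v (C *\<^sub>v g) + g) $ i = (C *\<^sub>v g) $ i" using i A C g by simp
  qed (use C g in auto)
  with v show ?thesis by blast
qed

text \<open>
  Subtracting \<open>v = A v + b\<close> from a step cancels \<open>b\<close>, so the error obeys the linear recursion
  \<open>d \<mapsto> A d\<close>. The solution is kept in the form error plus \<open>v\<close>, so that the induction needs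
  distributivity and associativity only.
\<close>

lemma affine_iteration_error:
  fixes A :: "'a :: comm_ring_1 mat"
  assumes A: "A \<in> carrier_mat n n" and b: "b \<in> carrier_vec n" and v: "v \<in> carrier_vec n"
    and fp: "A *\<^sub>v v + b = v" and x: "affine_iteration n A b x"
  shows "x m \<in> carrier_vec n \<and> x m = A ^\<^sub>m m *\<^sub>v (x 0 - v) + v"
proof (induction m)
  case 0
  have "x 0 \<in> carrier_vec n" using x by (simp add: affine_iteration_def)
  thus ?case using A v by auto
next
  case (Suc m)
  have x0: "x 0 \<in> carrier_vec n" using x by (simp add: affine_iteration_def)
  define d where "d = x 0 - v"
  have d: "d \<in> carrier_vec n" using x0 v by (simp add: d_def)
  note Am = pow_carrier_mat[OF A, of m]
  have comm: "A * A ^\<^sub>m m = A ^\<^sub>m m * A"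
    using A by (induction m) (auto simp: assoc_mult_mat[OF A pow_carrier_mat[OF A] A, symmetric])
  have "x (Suc m) = A *\<^sub>v x m + b"
    using x by (simp add: affine_iteration_def)
  also have "x m = A ^\<^sub>m m *\<^sub>v d + v" using Suc by (simp add: d_def)
  also have "A *\<^sub>v (A ^\<^sub>m m *\<^sub>v d + v) = (A * A ^\<^sub>m m) *\<^sub>v d + A *\<^sub>v v"
    using mult_add_distrib_mat_vec[OF A, of "A ^\<^sub>m m *\<^sub>v d" v] assoc_mult_mat_vec[OF A Am d] Am d v
    by simp
  also have "A * A ^\<^sub>m m = A ^\<^sub>m Suc m" using comm by simp
  also have "A ^\<^sub>m Suc m *\<^sub>v d + A *\<^sub>v v + b = A ^\<^sub>m Suc m *\<^sub>v d + v"
    using assoc_add_vec[OF mult_mat_vec_carrier[OF pow_carrier_mat[OF A] d]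
        mult_mat_vec_carrier[OF A v] b, of "Suc m"] by (simp only: fp)
  finally have "x (Suc m) = A ^\<^sub>m Suc m *\<^sub>v d + v" .
  moreover have "A ^\<^sub>m Suc m *\<^sub>v d + v \<in> carrier_vec n"
    using mult_mat_vec_carrier[OF pow_carrier_mat[OF A] d] v by (rule add_carrier_vec)
  ultimately show ?case by (simp add: d_def)
qed

lemma affine_iteration_tendsto_fixed_point:
  fixes A :: "complex mat"
  assumes A: "A \<in> carrier_mat n n" and b: "b \<in> carrier_vec n" and v: "v \<in> carrier_vec n"
    and fp: "A *\<^sub>v v + b = v" and x: "affine_iteration n A b x"
    and pow: "\<And>i j. i < n \<Longrightarrow> j < n \<Longrightarrow> (\<lambda>m. (A ^\<^sub>m m) $$ (i, j)) \<longlonglongrightarrow> 0"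
  shows "vec_LIMSEQ n x v"
  unfolding vec_LIMSEQ_def
proof (intro conjI allI impI)
  note err = affine_iteration_error[OF A b v fp x]
  show "x m \<in> carrier_vec n" for m using err by blast
  show "v \<in> carrier_vec n" by fact
  fix i assume i: "i < n"
  define d where "d = x 0 - v"
  have d: "d \<in> carrier_vec n" using v err[of 0] by (auto simp: d_def)
  have eq: "x m $ i = (\<Sum>j<n. (A ^\<^sub>m m) $$ (i, j) * d $ j) + v $ i" for m
  proof -
    have "x m $ i = (A ^\<^sub>m m *\<^sub>v d + v) $ i" using err[of m] by (simp add: d_def)
    thus ?thesis using i d v
      by (simp add: scalar_prod_def atLeast0LessThan carrier_matD[OF A])
  qed
  have "(\<lambda>m. (\<Sum>j<n. (A ^\<^sub>m m) $$ (i, j) * d $ j) + v $ i) \<longlonglongrightarrow> (\<Sum>j<n. 0 * d $ j) + v $ i"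
    using i pow by (intro tendsto_intros) auto
  thus "(\<lambda>m. x m $ i) \<longlonglongrightarrow> v $ i" by (simp add: eq)
qed

section \<open>Composing steps of the iteration\<close>

lemma mat_geometric_sum_0 [simp]: "mat_geometric_sum n A 0 = 0\<^sub>m n n"
proof -
  interpret ring "ring_mat TYPE('a) n ()" by (rule ring_mat)
  show ?thesis by (simp add: mat_geometric_sum_def ring_mat_simps)
qed

lemma mat_geometric_sum_carrier_and_Suc:
  fixes A :: "'a :: comm_ring_1 mat"
  assumes A: "A \<in> carrier_mat n n"
  shows mat_geometric_sum_carrier: "mat_geometric_sum n A k \<in> carrier_mat n n"
    and mat_geometric_sum_Suc:
      "mat_geometric_sum n A (Suc k) = A ^\<^sub>m k + mat_geometric_sum n A k"
proof -
  interpret ring "ring_mat TYPE('a) n ()" by (rule ring_mat)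
  have mem: "A ^\<^sub>m i \<in> carrier (ring_mat TYPE('a) n ())" for i
    using A by (simp add: ring_mat_simps)
  show "mat_geometric_sum n A k \<in> carrier_mat n n"
    using finsum_closed[of "\<lambda>i. A ^\<^sub>m i" "{..<k}"] mem
    by (simp add: mat_geometric_sum_def ring_mat_simps)
  show "mat_geometric_sum n A (Suc k) = A ^\<^sub>m k + mat_geometric_sum n A k"
    using finsum_insert[of "{..<k}" k "\<lambda>i. A ^\<^sub>m i"] mem
    by (simp add: mat_geometric_sum_def lessThan_Suc) (simp add: ring_mat_simps)
qed

text \<open>
  Substituting \<open>v = A v + g\<close> into the innermost \<open>v\<close> of \<open>A\<^sup>k v\<close> releases the next term
  \<open>A\<^sup>k g\<close> of the geometric sum. This unrolling works for any fixed point; solving for \<open>v\<close> with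
  an inverse of \<open>I - A\<close> is avoided.
\<close>

lemma fixed_point_of_pow:
  fixes A :: "'a :: comm_ring_1 mat"
  assumes A: "A \<in> carrier_mat n n" and g: "g \<in> carrier_vec n" and v: "v \<in> carrier_vec n"
    and fp: "A *\<^sub>v v + g = v"
  shows "A ^\<^sub>m k *\<^sub>v v + mat_geometric_sum n A k *\<^sub>v g = v"
proof (induction k)
  case 0
  have "0\<^sub>m n n *\<^sub>v g = 0\<^sub>v n" using g by (intro eq_vecI) (auto simp: scalar_prod_def)
  thus ?case using A v by simp
next
  case (Suc k)
  note Ak = pow_carrier_mat[OF A, of k]
  let ?S = "mat_geometric_sum n A k"
  have S: "?S \<in> carrier_mat n n" by (rule mat_geometric_sum_carrier[OF A])
  have "A ^\<^sub>m Suc k *\<^sub>v v + mat_geometric_sum n A (Suc k) *\<^sub>v g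
      = A ^\<^sub>m k *\<^sub>v (A *\<^sub>v v) + (A ^\<^sub>m k *\<^sub>v g + ?S *\<^sub>v g)"
    using A Ak S g v
    by (simp add: mat_geometric_sum_Suc[OF A] add_mult_distrib_mat_vec[of _ n n]
        assoc_mult_mat_vec[OF Ak A v])
  also have "\<dots> = A ^\<^sub>m k *\<^sub>v (A *\<^sub>v v) + A ^\<^sub>m k *\<^sub>v g + ?S *\<^sub>v g"
    by (rule assoc_add_vec[OF mult_mat_vec_carrier[OF Ak mult_mat_vec_carrier[OF A v]]
          mult_mat_vec_carrier[OF Ak g] mult_mat_vec_carrier[OF S g], symmetric])
  also have "A ^\<^sub>m k *\<^sub>v (A *\<^sub>v v) + A ^\<^sub>m k *\<^sub>v g = A ^\<^sub>m k *\<^sub>v (A *\<^sub>v v + g)"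
    by (rule mult_add_distrib_mat_vec[OF Ak mult_mat_vec_carrier[OF A v] g, symmetric])
  also have "\<dots> + ?S *\<^sub>v g = v" using Suc by (simp add: fp)
  finally show ?case .
qed

theorem lemma1:
  fixes n k :: nat and M :: "complex mat" and g h :: "complex vec"
  assumes "M \<in> carrier_mat n n"
    and "spectral_radius M < 1"
    and "g \<in> carrier_vec n"
    and "k \<ge> 1"
    and "h = mat_geometric_sum n M k *\<^sub>v g"
  shows "\<exists>v \<in> carrier_vec n.
           (\<forall>x. affine_iteration n M g x \<longrightarrow> vec_LIMSEQ n x v) \<and>
           (\<forall>y. affine_iteration n (M ^\<^sub>m k) h y \<longrightarrow> vec_LIMSEQ n y v)"
proof -
  note M = assms(1) and g = assms(3)
  have "\<not> eigenvalue M 1"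
    using norm_eigenvalue_le_spectral_radius[OF M, of 1] assms(2) by auto
  from fixed_point_exists[OF M g this]
  obtain v where v: "v \<in> carrier_vec n" and fp: "M *\<^sub>v v + g = v" by blast
  have Mk: "M ^\<^sub>m k \<in> carrier_mat n n" using M by simp
  have h: "h \<in> carrier_vec n"
    using mult_mat_vec_carrier[OF mat_geometric_sum_carrier[OF M] g] by (simp add: assms(5))
  have fpk: "M ^\<^sub>m k *\<^sub>v v + h = v"
    using fixed_point_of_pow[OF M g v fp] by (simp add: assms(5))
  note pow = pow_mat_tendsto_zero[OF M assms(2)]
  have powk: "(\<lambda>m. ((M ^\<^sub>m k) ^\<^sub>m m) $$ (i, j)) \<longlonglongrightarrow> 0" if "i < n" "j < n" for i j
  proof -
    have "strict_mono (\<lambda>m. k * m)" using assms(4) by (simp add: strict_mono_def)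
    from LIMSEQ_subseq_LIMSEQ[OF pow[OF that] this] show ?thesis
      by (simp add: comp_def pow_mat_pow_mat[OF M])
  qed
  show ?thesis
    using affine_iteration_tendsto_fixed_point[OF M g v fp _ pow]
      affine_iteration_tendsto_fixed_point[OF Mk h v fpk _ powk] v
    by blast
qed

end
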